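(* Let $a,b$ be real constants with $b\neq 0$. Let $\Gamma$ be an open arc of the unit circle $\{|z|=1\}$ centered at the origin, and let $\Omega\subset\mathbb{C}\setminus\{0\}$ be a simply connected domain containing $\Gamma$ and invariant under the reflection $z\mapsto 1/\bar z$. Let $\varphi_w(z,\zeta)$ be holomorphic in a neighborhood in $\mathbb{C}^2$ of the set $\{(z,1/z): z\in\Omega\}$. Let $w$ be harmonic in $\Omega$ and satisfy the Robin condition $a\,w(z)+b\,\frac{\partial w}{\partial n}(z)=\varphi_w(z,\bar z)$ for $z\in\Gamma$. Then for every pair of points $re^{i\theta},\ \frac1r e^{i\theta}\in\Omega$ ($r>0$) symmetric with respect to the unit circle, such that $e^{i\theta}\in\Gamma$ and the closed radial segment joining them lies in $\Omega$, $$w\Bigl(\frac{e^{i\theta}}{r}\Bigr)=w(re^{i\theta})-\frac{a}{b}\int_r^1\frac{w(\rho e^{i\theta})+w\bigl(\frac1\rho e^{i\theta}\bigr)}{\rho}\,d\rho-\frac1b\int_{1/r}^{r}\frac{\varphi_w\bigl(\rho e^{i\theta},\frac{1}{\rho e^{i\theta}}\bigr)}{\rho}\,d\rho .$$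
   Context: Points of $\mathbb{R}^2$ are identified with $z=x+iy\in\mathbb{C}$, and $w(z)$ denotes the value of the harmonic function $w$ at the point $z$ of the plane. The boundary data are complexified via $z=x+iy$, $\zeta=x-iy$, regarded as independent complex variables, so that the real plane corresponds to $\zeta=\bar z$ and the complexified unit circle is $\{z\zeta=1\}$. Here $n$ is the outward unit normal to the unit circle, so $\frac{\partial}{\partial n}$ on $\Gamma$ is the radial derivative at $r=1$. *)

theory Defs
  imports "HOL-Analysis.Analysis"
begin

text \<open>
  Points of the plane are complex numbers \<open>x + \<i> y\<close>.  A real-valued function on an open set
  is harmonic if it is twice continuously differentiable with vanishing Laplacian; the witnesses
  \<open>wx\<close>, \<open>wy\<close>, \<open>wxx\<close>, ... below are its first and second partial derivatives.
\<close>

definition harmonic_on :: "(complex \<Rightarrow> real) \<Rightarrow> complex set \<Rightarrow> bool" where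
  "harmonic_on w S \<longleftrightarrow> open S \<and>
     (\<exists>wx wy wxx wxy wyx wyy :: complex \<Rightarrow> real.
        (\<forall>z\<in>S. (w has_derivative (\<lambda>h. wx z * Re h + wy z * Im h)) (at z)) \<and>
        (\<forall>z\<in>S. (wx has_derivative (\<lambda>h. wxx z * Re h + wxy z * Im h)) (at z)) \<and>
        (\<forall>z\<in>S. (wy has_derivative (\<lambda>h. wyx z * Re h + wyy z * Im h)) (at z)) \<and>
        continuous_on S wxx \<and> continuous_on S wxy \<and>
        continuous_on S wyx \<and> continuous_on S wyy \<and>
        (\<forall>z\<in>S. wxx z + wyy z = 0))"

text \<open>
  Holomorphy in two complex variables on an open set: the Frechet derivative exists at every
  point and is complex-linear.
\<close>

definition holomorphic2_on :: "(complex \<times> complex \<Rightarrow> complex) \<Rightarrow> (complex \<times> complex) set \<Rightarrow> bool" where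
  "holomorphic2_on f U \<longleftrightarrow> open U \<and>
     (\<forall>p\<in>U. \<exists>A B. (f has_derivative (\<lambda>(u, v). A * u + B * v)) (at p))"

definition open_circle_arc :: "complex set \<Rightarrow> bool" where
  "open_circle_arc \<Gamma> \<longleftrightarrow> (\<exists>\<alpha> \<beta>. \<alpha> < \<beta> \<and> \<beta> \<le> \<alpha> + 2 * pi \<and> \<Gamma> = cis ` {\<alpha><..<\<beta>})"

text \<open>
  On the unit circle the outward unit normal at \<open>z\<close> is \<open>z\<close> itself, so the normal derivative is
  the radial derivative at radius 1.
\<close>

definition normal_deriv :: "(complex \<Rightarrow> real) \<Rightarrow> complex \<Rightarrow> real" where
  "normal_deriv w z = deriv (\<lambda>r. w (of_real r * z)) 1"

end

theory Submission
  imports Defs "HOL-Complex_Analysis.Complex_Analysis"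
begin

text \<open>On the simply connected \<open>\<Omega>\<close> the harmonic \<open>w\<close> is the
  real part of a holomorphic \<open>f\<close> (\<open>harmonic_on_eq_Re\<close>). With
  \<open>g\<close> the derivative of \<open>f\<close>, the derivative of \<open>w\<close> along a
  ray, multiplied by the radius, is \<open>Re (z * g z)\<close>; at radius 1 this is the normal
  derivative.

  On the unit circle \<open>cnj z = 1 / z\<close>. Hence the Robin data are the values of the
  holomorphic function \<open>\<psi> z = \<phi> (z, 1 / z)\<close>
  (\<open>holomorphic2_on_hyperbola\<close>), and the conjugates hidden in the real parts are the
  values of reflected holomorphic functions (\<open>holomorphic_on_reflection\<close>). The Robin
  condition is thus an equation between holomorphic functions on an arc, and by the identity theorem
  it holds in all of \<open>\<Omega>\<close>. Adding this equation at \<open>z\<close> and at its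
  mirror image \<open>1 / cnj z\<close> pairs each term with its conjugate and leaves a relation
  between \<open>\<psi>\<close>, \<open>w\<close> and the radial derivatives at the two points
  (\<open>robin_reflection\<close>).

  Along the ray, dividing that relation by the radius \<open>t\<close> turns the terms with
  \<open>\<psi>\<close> and with the radial derivatives into exact derivatives. Integrating from
  \<open>r\<close> to 1, the fixed point of \<open>t \<mapsto> 1 / t\<close>, yields the formula
  (\<open>radial_integral_identity\<close>).\<close>

section \<open>Symmetry of mixed partial derivatives\<close>

text \<open>The mean value theorem is applied twice: in \<open>x\<close> to the difference of
  \<open>W\<close> between the top and bottom edges of the square, then in \<open>y\<close> to
  \<open>Wx\<close>.\<close>

lemma second_difference_mvt:
  fixes W Wx Wxy :: "real \<Rightarrow> real \<Rightarrow> real"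
  assumes "h > 0"
    and dx: "\<And>x y. \<lbrakk>x \<in> {x0..x0+h}; y \<in> {y0..y0+h}\<rbrakk> \<Longrightarrow>
               ((\<lambda>x. W x y) has_real_derivative Wx x y) (at x)"
    and dy: "\<And>x y. \<lbrakk>x \<in> {x0..x0+h}; y \<in> {y0..y0+h}\<rbrakk> \<Longrightarrow>
               ((\<lambda>y. Wx x y) has_real_derivative Wxy x y) (at y)"
  obtains \<xi> \<eta> where "\<xi> \<in> {x0..x0+h}" "\<eta> \<in> {y0..y0+h}"
    "W (x0+h) (y0+h) - W (x0+h) y0 - W x0 (y0+h) + W x0 y0 = h * h * Wxy \<xi> \<eta>"
proof -
  have "\<exists>\<xi>. \<xi> > x0 \<and> \<xi> < x0 + h \<and>
      (W (x0+h) (y0+h) - W (x0+h) y0) - (W x0 (y0+h) - W x0 y0)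
        = (x0 + h - x0) * (Wx \<xi> (y0+h) - Wx \<xi> y0)"
    using \<open>h > 0\<close> by (intro MVT2 DERIV_diff dx) auto
  then obtain \<xi> where \<xi>: "\<xi> > x0" "\<xi> < x0 + h"
    and 1: "(W (x0+h) (y0+h) - W (x0+h) y0) - (W x0 (y0+h) - W x0 y0)
        = (x0 + h - x0) * (Wx \<xi> (y0+h) - Wx \<xi> y0)" by blast
  have "\<exists>\<eta>. \<eta> > y0 \<and> \<eta> < y0 + h \<and> Wx \<xi> (y0+h) - Wx \<xi> y0 = (y0 + h - y0) * Wxy \<xi> \<eta>"
    using \<open>h > 0\<close> \<xi> by (intro MVT2 dy) auto
  then obtain \<eta> where "\<eta> > y0" "\<eta> < y0 + h"
    "Wx \<xi> (y0+h) - Wx \<xi> y0 = (y0 + h - y0) * Wxy \<xi> \<eta>" by blast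
  with 1 \<xi> show ?thesis
    by (intro that[of \<xi> \<eta>]) auto
qed

lemma has_real_derivative_along_curve:
  fixes w :: "'a::real_normed_vector \<Rightarrow> real"
  assumes "(w has_derivative D) (at (c t))"
    and "(c has_vector_derivative c') (at t)"
  shows "((\<lambda>t. w (c t)) has_real_derivative D c') (at t)"
proof -
  have "(w \<circ> c has_vector_derivative D c') (at t)"
    using has_derivative_at_withinI[OF assms(1), of "range c"] assms(2)
    by (auto intro: vector_derivative_diff_chain_within)
  then show ?thesis
    by (simp add: has_real_derivative_iff_has_vector_derivative o_def)
qed

text \<open>Schwarz's theorem: one and the same second difference over a small square equals
  \<open>h * h\<close> times \<open>wxy\<close> at one point of the square and \<open>h * h\<close>
  times \<open>wyx\<close> at another, and continuity carries both values to
  \<open>z\<close>.\<close>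

lemma mixed_partials_eq:
  fixes w :: "complex \<Rightarrow> real"
  assumes "open S" "z \<in> S"
    and w: "\<And>z. z \<in> S \<Longrightarrow> (w has_derivative (\<lambda>h. wx z * Re h + wy z * Im h)) (at z)"
    and wx: "\<And>z. z \<in> S \<Longrightarrow> (wx has_derivative (\<lambda>h. wxx z * Re h + wxy z * Im h)) (at z)"
    and wy: "\<And>z. z \<in> S \<Longrightarrow> (wy has_derivative (\<lambda>h. wyx z * Re h + wyy z * Im h)) (at z)"
    and cont: "continuous_on S wxy" "continuous_on S wyx"
  shows "wxy z = wyx z"
proof -
  have "\<bar>wxy z - wyx z\<bar> \<le> e" if "e > 0" for e :: real
  proof -
    have *: "isCont wxy z" "isCont wyx z"
      using assms by (auto simp: continuous_on_eq_continuous_at)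
    obtain d1 where d1: "d1 > 0" "\<And>u. dist u z < d1 \<Longrightarrow> dist (wxy u) (wxy z) < e / 2"
      using * \<open>e > 0\<close> unfolding continuous_at_eps_delta by (meson half_gt_zero)
    obtain d2 where d2: "d2 > 0" "\<And>u. dist u z < d2 \<Longrightarrow> dist (wyx u) (wyx z) < e / 2"
      using * \<open>e > 0\<close> unfolding continuous_at_eps_delta by (meson half_gt_zero)
    obtain d3 where d3: "d3 > 0" "ball z d3 \<subseteq> S"
      using assms(1,2) openE by blast
    \<comment> \<open>Points of the square of side \<open>h\<close> with lower left corner
      \<open>z\<close> are within \<open>2 * h\<close> of \<open>z\<close>; the factor 3 makes this
      strictly less than all three radii.\<close>
    define h where "h = min d1 (min d2 d3) / 3"
    have h: "h > 0" using d1 d2 d3 by (auto simp: h_def)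
    have near: "dist (Complex x y) z < min d1 (min d2 d3)"
      if "x \<in> {Re z..Re z + h}" "y \<in> {Im z..Im z + h}" for x y
    proof -
      have "dist (Complex x y) z \<le> \<bar>x - Re z\<bar> + \<bar>y - Im z\<bar>"
        unfolding dist_norm using cmod_le[of "Complex x y - z"] by simp
      also have "\<dots> \<le> 2 * h" using that by auto
      also have "\<dots> < min d1 (min d2 d3)" using h by (auto simp: h_def)
      finally show ?thesis .
    qed
    have inS: "Complex x y \<in> S"
      if "x \<in> {Re z..Re z + h}" "y \<in> {Im z..Im z + h}" for x y
      using near[OF that] d3 by (auto simp: dist_commute)
    have lx: "((\<lambda>x. Complex x y) has_vector_derivative 1) (at x)" for x y
      unfolding Complex_eq by (auto intro!: derivative_eq_intros)
    have ly: "((\<lambda>y. Complex x y) has_vector_derivative \<i>) (at y)" for x y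
      unfolding Complex_eq by (auto intro!: derivative_eq_intros)
    have dx: "((\<lambda>x. f (Complex x y)) has_real_derivative p) (at x)"
      if "(f has_derivative (\<lambda>h. p * Re h + q * Im h)) (at (Complex x y))" for f p q x y
      using has_real_derivative_along_curve[OF that lx] by simp
    have dy: "((\<lambda>y. f (Complex x y)) has_real_derivative q) (at y)"
      if "(f has_derivative (\<lambda>h. p * Re h + q * Im h)) (at (Complex x y))" for f p q x y
      using has_real_derivative_along_curve[OF that ly] by simp
    let ?D = "w (Complex (Re z + h) (Im z + h)) - w (Complex (Re z + h) (Im z))
      - w (Complex (Re z) (Im z + h)) + w (Complex (Re z) (Im z))"
    obtain x y where xy: "x \<in> {Re z..Re z + h}" "y \<in> {Im z..Im z + h}"
      and 1: "?D = h * h * wxy (Complex x y)"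
      by (rule second_difference_mvt[OF h, of "Re z" "Im z" "\<lambda>x y. w (Complex x y)"
            "\<lambda>x y. wx (Complex x y)" "\<lambda>x y. wxy (Complex x y)"])
         (blast intro: dx[OF w] dy[OF wx] inS)+
    \<comment> \<open>The same second difference with the roles of the coordinates exchanged; only
      its two middle terms change order.\<close>
    obtain y' x' where xy': "x' \<in> {Re z..Re z + h}" "y' \<in> {Im z..Im z + h}"
      and 2: "w (Complex (Re z + h) (Im z + h)) - w (Complex (Re z) (Im z + h))
        - w (Complex (Re z + h) (Im z)) + w (Complex (Re z) (Im z)) = h * h * wyx (Complex x' y')"
      by (rule second_difference_mvt[OF h, of "Im z" "Re z" "\<lambda>y x. w (Complex x y)"
            "\<lambda>y x. wy (Complex x y)" "\<lambda>y x. wyx (Complex x y)"])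
         (blast intro: dy[OF w] dx[OF wy] inS)+
    have "h * h * wxy (Complex x y) = h * h * wyx (Complex x' y')"
      using 1 2 by linarith
    then have "wxy (Complex x y) = wyx (Complex x' y')" using h by simp
    moreover have "dist (wxy (Complex x y)) (wxy z) < e / 2"
      using near[OF xy] d1 by simp
    moreover have "dist (wyx (Complex x' y')) (wyx z) < e / 2"
      using near[OF xy'] d2 by simp
    ultimately show ?thesis unfolding dist_real_def by linarith
  qed
  then have "\<bar>wxy z - wyx z\<bar> \<le> 0" by (rule field_le_epsilon[of _ 0, simplified])
  then show ?thesis by simp
qed

section \<open>Harmonic functions as real parts of holomorphic functions\<close>

text \<open>The function \<open>wx - \<i> * wy\<close> satisfies the Cauchy-Riemann equations: one
  is Laplace's equation, the other the symmetry of mixed partials. Simple connectedness gives it a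
  primitive, whose real part has the gradient of \<open>w\<close> and so differs from
  \<open>w\<close> by a constant, which is absorbed into \<open>f\<close>. The middle conclusion
  expresses directional derivatives of \<open>w\<close> through \<open>g\<close>.\<close>

lemma harmonic_on_eq_Re:
  assumes w: "harmonic_on w S" and S: "simply_connected S"
  obtains f g where "\<And>z. z \<in> S \<Longrightarrow> (f has_field_derivative g z) (at z)"
    and "\<And>z. z \<in> S \<Longrightarrow> (w has_derivative (\<lambda>h. Re (g z * h))) (at z)"
    and "\<And>z. z \<in> S \<Longrightarrow> w z = Re (f z)"
proof (cases "S = {}")
  case False
  obtain wx wy wxx wxy wyx wyy :: "complex \<Rightarrow> real" where
    "open S"
    and dw: "\<And>z. z\<in>S \<Longrightarrow> (w has_derivative (\<lambda>h. wx z * Re h + wy z * Im h)) (at z)"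
    and dwx: "\<And>z. z\<in>S \<Longrightarrow> (wx has_derivative (\<lambda>h. wxx z * Re h + wxy z * Im h)) (at z)"
    and dwy: "\<And>z. z\<in>S \<Longrightarrow> (wy has_derivative (\<lambda>h. wyx z * Re h + wyy z * Im h)) (at z)"
    and cont: "continuous_on S wxy" "continuous_on S wyx"
    and lap: "\<And>z. z\<in>S \<Longrightarrow> wxx z + wyy z = 0"
    using w unfolding harmonic_on_def by blast
  define g where "g z = Complex (wx z) (- wy z)" for z
  have "(g has_field_derivative Complex (wxx z) (- wyx z)) (at z)" if z: "z \<in> S" for z
  proof -
    have eq: "wxy z = wyx z"
      by (rule mixed_partials_eq[OF \<open>open S\<close> z dw dwx dwy cont])
    have yy: "wyy z = - wxx z"
      using lap[OF z] by linarith
    have "((\<lambda>z. of_real (wx z) - \<i> * of_real (wy z)) has_derivative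
       (\<lambda>h. of_real (wxx z * Re h + wxy z * Im h) - \<i> * of_real (wyx z * Re h + wyy z * Im h))) (at z)"
      by (intro derivative_intros dwx dwy z)
    also have "(\<lambda>z. of_real (wx z) - \<i> * of_real (wy z)) = g"
      by (auto simp: g_def complex_eq_iff)
    also have "(\<lambda>h. of_real (wxx z * Re h + wxy z * Im h) - \<i> * of_real (wyx z * Re h + wyy z * Im h))
       = (*) (Complex (wxx z) (- wyx z))"
      unfolding eq yy by (auto simp: complex_eq_iff fun_eq_iff)
    finally show ?thesis by (simp add: has_field_derivative_def)
  qed
  then have "g holomorphic_on S"
    using \<open>open S\<close> holomorphic_on_open by blast
  then obtain f where f: "\<And>z. z \<in> S \<Longrightarrow> (f has_field_derivative g z) (at z)"
    using simply_connected_eq_global_primitive[OF \<open>open S\<close>] S by blast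
  have "connected S" using S by (rule simply_connected_imp_connected)
  have d0: "((\<lambda>z. w z - Re (f z)) has_derivative (\<lambda>_. 0)) (at z)" if z: "z \<in> S" for z
  proof -
    have "((\<lambda>z. w z - Re (f z)) has_derivative
      (\<lambda>h. (wx z * Re h + wy z * Im h) - Re (g z * h))) (at z)"
      using f[OF z] unfolding has_field_derivative_def by (intro derivative_intros dw z)
    then show ?thesis by (simp add: g_def)
  qed
  obtain p where "p \<in> S" using False by blast
  define k where "k = w p - Re (f p)"
  show ?thesis
  proof (rule that)
    show "((\<lambda>z. f z + of_real k) has_field_derivative g z) (at z)" if "z \<in> S" for z
      using f[OF that] by (auto intro!: derivative_eq_intros)
    show "(w has_derivative (\<lambda>h. Re (g z * h))) (at z)" if "z \<in> S" for z
      using dw[OF that] by (simp add: g_def)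
    show "w z = Re (f z + of_real k)" if "z \<in> S" for z
      using has_derivative_zero_unique_connected[OF \<open>open S\<close> \<open>connected S\<close> d0 that \<open>p \<in> S\<close>]
      by (simp add: k_def)
  qed
qed (use that in auto)

section \<open>Complexified boundary data, reflection and the identity theorem\<close>

text \<open>The chain rule along \<open>z \<mapsto> (z, 1 / z)\<close> turns the complex-linear
  derivative with coefficients \<open>A\<close> and \<open>B\<close> into multiplication by
  \<open>A - B / z\<^sup>2\<close>.\<close>

lemma holomorphic2_on_hyperbola:
  assumes "holomorphic2_on \<phi> U" "open S" "0 \<notin> S" "{(z, 1 / z) | z. z \<in> S} \<subseteq> U"
  shows "(\<lambda>z. \<phi> (z, 1 / z)) holomorphic_on S"
proof -
  have "(\<lambda>z. \<phi> (z, 1 / z)) field_differentiable at z" if z: "z \<in> S" for z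
  proof -
    obtain A B where "(\<phi> has_derivative (\<lambda>(u, v). A * u + B * v)) (at (z, 1 / z))"
      using assms z unfolding holomorphic2_on_def by blast
    moreover have "z \<noteq> 0" using z assms(3) by auto
    then have "((\<lambda>z. (z, 1 / z)) has_derivative (\<lambda>h. (h, - h / z\<^sup>2))) (at z)"
      by (auto intro!: derivative_eq_intros simp: power2_eq_square divide_simps)
    ultimately have "((\<lambda>z. \<phi> (z, 1 / z)) has_derivative (\<lambda>h. case (h, - h / z\<^sup>2) of (u, v) \<Rightarrow> A * u + B * v)) (at z)"
      using diff_chain_at[of "\<lambda>z. (z, 1 / z)"] by (fastforce simp: o_def)
    also have "(\<lambda>h. case (h, - h / z\<^sup>2) of (u, v) \<Rightarrow> A * u + B * v) = (*) (A - B / z\<^sup>2)"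
      by (auto simp: algebra_simps)
    finally show ?thesis
      unfolding field_differentiable_def has_field_derivative_def by blast
  qed
  then show ?thesis using assms(2) by (simp add: holomorphic_on_def field_differentiable_at_within)
qed

text \<open>A connected set with more than one point has no isolated points. This supplies the
  accumulation point of zeros for the identity theorem.\<close>

lemma open_circle_arc_islimpt:
  assumes "open_circle_arc \<Gamma>" "p \<in> \<Gamma>"
  shows "p islimpt \<Gamma>"
proof -
  obtain \<alpha> \<beta> t where ab: "\<alpha> < \<beta>" "\<beta> \<le> \<alpha> + 2 * pi" and \<Gamma>: "\<Gamma> = cis ` {\<alpha><..<\<beta>}"
    and t: "t \<in> {\<alpha><..<\<beta>}" "p = cis t"
    using assms unfolding open_circle_arc_def by blast
  have "connected \<Gamma>" unfolding \<Gamma>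
    by (intro connected_continuous_image continuous_intros) auto
  moreover have "\<Gamma> \<noteq> {p}"
  proof
    assume "\<Gamma> = {p}"
    \<comment> \<open>Two angles with the same \<open>cis\<close> differ by a multiple of
      \<open>2 * pi\<close>, but the open interval of angles has length at most
      \<open>2 * pi\<close>, so distinct angles in it give distinct points.\<close>
    obtain s where s: "s \<in> {\<alpha><..<\<beta>}" "s < t" using t(1) dense[of \<alpha> t] by fastforce
    have "cis s = cis t" using s \<open>\<Gamma> = {p}\<close> t \<Gamma> by blast
    then have "sin s = sin t \<and> cos s = cos t" by (simp add: complex_eq_iff)
    then obtain n :: int where n: "s = t + 2 * pi * of_int n"
      by (auto simp: sin_cos_eq_iff)
    have "\<bar>2 * pi * of_int n\<bar> < 2 * pi * 1" using n s t ab by auto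
    then have "\<bar>real_of_int n\<bar> < 1" by (simp add: abs_mult)
    then have "n = 0" by linarith
    with n s show False by simp
  qed
  ultimately show ?thesis
    using assms(2) connected_imp_perfect by blast
qed

lemma open_circle_arc_norm: "open_circle_arc \<Gamma> \<Longrightarrow> z \<in> \<Gamma> \<Longrightarrow> norm z = 1"
  by (auto simp: open_circle_arc_def)

text \<open>Schwarz reflection in the unit circle: since \<open>1 / cnj z = cnj (1 / z)\<close>, the
  function is \<open>cnj \<circ> f \<circ> cnj\<close>, holomorphic on the conjugate domain,
  composed with \<open>1 / z\<close>.\<close>

lemma holomorphic_on_reflection:
  assumes f: "f holomorphic_on S" and "open S" "0 \<notin> S" and refl: "\<And>z. z \<in> S \<Longrightarrow> 1 / cnj z \<in> S"
  shows "(\<lambda>z. cnj (f (1 / cnj z))) holomorphic_on S"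
proof -
  have "(cnj \<circ> f \<circ> cnj) holomorphic_on (cnj ` S)"
  proof (rule holomorphic_on_compose_cnj_cnj)
    show "f holomorphic_on cnj ` cnj ` S" using f by (simp add: image_image)
    show "open (cnj ` S)"
      unfolding image_cnj_conv_vimage_cnj using \<open>open S\<close> by (intro open_vimage continuous_intros)
  qed
  moreover have "(\<lambda>z. 1 / z) ` S \<subseteq> cnj ` S"
    using refl by (force simp: image_iff)
  moreover have "(\<lambda>z. 1 / z) holomorphic_on S"
    using \<open>0 \<notin> S\<close> by (intro holomorphic_intros) auto
  ultimately have "(cnj \<circ> f \<circ> cnj) \<circ> (\<lambda>z. 1 / z) holomorphic_on S"
    by (meson holomorphic_on_compose holomorphic_on_subset)
  then show ?thesis by (simp add: o_def)
qed

text \<open>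
  On the circle \<open>1 / cnj z = z\<close>, so that twice the Robin condition says \<open>a (f + f\<^sup>*) + b (z g + (z g)\<^sup>*) = 2 \<phi> (z, 1 / z)\<close>
  with \<open>h\<^sup>* z = cnj (h (1 / cnj z))\<close>; both sides are holomorphic. Adding the identity at \<open>z\<close>
  and at \<open>1 / cnj z\<close> leaves only real parts.
\<close>
lemma robin_reflection:
  fixes a b :: real
  assumes f: "\<And>z. z \<in> \<Omega> \<Longrightarrow> (f has_field_derivative g z) (at z)"
    and \<psi>: "\<psi> holomorphic_on \<Omega>"
    and \<Gamma>: "open_circle_arc \<Gamma>" "\<Gamma> \<subseteq> \<Omega>" "p \<in> \<Gamma>"
    and \<Omega>: "open \<Omega>" "connected \<Omega>" "0 \<notin> \<Omega>"
    and refl: "\<And>z. z \<in> \<Omega> \<Longrightarrow> 1 / cnj z \<in> \<Omega>"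
    and robin: "\<And>z. z \<in> \<Gamma> \<Longrightarrow> complex_of_real (a * Re (f z) + b * Re (z * g z)) = \<psi> z"
    and z: "z \<in> \<Omega>"
  shows "\<psi> z + \<psi> (1 / cnj z) =
    of_real (a * (Re (f z) + Re (f (1 / cnj z)))
      + b * (Re (z * g z) + Re (1 / cnj z * g (1 / cnj z))))"
proof -
  have hf: "f holomorphic_on \<Omega>"
    using f \<Omega>(1) holomorphic_on_open by blast
  have "deriv f holomorphic_on \<Omega>"
    using hf \<Omega>(1) by (rule holomorphic_deriv)
  then have hg: "g holomorphic_on \<Omega>"
    by (rule holomorphic_transform) (simp add: f DERIV_imp_deriv)
  have hzg: "(\<lambda>z. z * g z) holomorphic_on \<Omega>"
    by (intro holomorphic_intros hg)
  define K where "K z = of_real a / 2 * (f z + cnj (f (1 / cnj z)))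
    + of_real b / 2 * (z * g z + cnj (1 / cnj z * g (1 / cnj z))) - \<psi> z" for z
  have K: "K holomorphic_on \<Omega>" unfolding K_def
    by (intro holomorphic_intros holomorphic_on_reflection[OF hf \<Omega>(1,3) refl] hf hzg \<psi>
        holomorphic_on_reflection[OF hzg \<Omega>(1,3) refl])
  have K0: "K z = 0" if z: "z \<in> \<Gamma>" for z
  proof -
    have "z * cnj z = 1"
      using open_circle_arc_norm[OF \<Gamma>(1) z] by (simp add: complex_norm_square[symmetric])
    then have eq: "1 / cnj z = z"
      by (metis complex_cnj_zero divide_eq_eq mult_zero_right zero_neq_one)
    show ?thesis
      unfolding K_def eq robin[OF z, symmetric] by (simp add: complex_eq_iff field_simps)
  qed
  \<comment> \<open>Identity theorem on the connected \<open>\<Omega>\<close>, with zeros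
    accumulating at \<open>p\<close>.\<close>
  have K0: "K z = 0" if "z \<in> \<Omega>" for z
    using analytic_continuation[OF K \<Omega>(1,2) \<Gamma>(2) _ open_circle_arc_islimpt[OF \<Gamma>(1,3)] K0 that] \<Gamma>
    by auto
  have real_parts: "of_real a / 2 * (X + cnj Y) + of_real b / 2 * (A + cnj B)
      + (of_real a / 2 * (Y + cnj X) + of_real b / 2 * (B + cnj A)) =
      of_real (a * (Re X + Re Y) + b * (Re A + Re B))" for X Y A B :: complex
    by (simp add: complex_eq_iff field_simps)
  \<comment> \<open>Reflection is an involution, so \<open>K\<close> at the mirror image involves
    the same values of \<open>f\<close> and \<open>g\<close> as \<open>K\<close> at
    \<open>z\<close>, with the conjugations exchanged.\<close>
  have "1 / cnj (1 / cnj z) = z" by simp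
  then have "\<psi> z + \<psi> (1 / cnj z) = of_real a / 2 * (f z + cnj (f (1 / cnj z)))
    + of_real b / 2 * (z * g z + cnj (1 / cnj z * g (1 / cnj z)))
    + (of_real a / 2 * (f (1 / cnj z) + cnj (f z))
    + of_real b / 2 * (1 / cnj z * g (1 / cnj z) + cnj (z * g z)))"
    using K0[OF z] K0[OF refl[OF z]] unfolding K_def by (simp only: diff_eq_eq add_0)
  also have "\<dots> = of_real (a * (Re (f z) + Re (f (1 / cnj z)))
      + b * (Re (z * g z) + Re (1 / cnj z * g (1 / cnj z))))"
    by (rule real_parts)
  finally show ?thesis .
qed

section \<open>Integration along a ray\<close>

lemma rcis_inverse_eq: "1 / cnj (rcis t \<theta>) = rcis (1 / t) \<theta>"
  by (simp add: rcis_def cis_cnj cis_mult divide_simps)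

lemma rcis_in_closed_segment:
  assumes "t \<in> {min r s..max r s}"
  shows "rcis t \<theta> \<in> closed_segment (rcis r \<theta>) (rcis s \<theta>)"
proof -
  have "t \<in> closed_segment r s"
    using assms by (auto simp: closed_segment_eq_real_ivl min_def max_def split: if_splits)
  then obtain u where u: "0 \<le> u" "u \<le> 1" and t: "t = (1 - u) * r + u * s"
    by (auto simp: in_segment)
  have "rcis t \<theta> = (1 - u) *\<^sub>R rcis r \<theta> + u *\<^sub>R rcis s \<theta>"
    unfolding t by (simp add: rcis_def scaleR_conv_of_real algebra_simps)
  with u show ?thesis
    unfolding in_segment by blast
qed

lemma normal_deriv_eq:
  assumes "(w has_derivative D) (at z)"
  shows "normal_deriv w z = D z"
proof -
  have "((\<lambda>r. of_real r * z) has_vector_derivative z) (at 1)"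
    by (auto intro!: derivative_eq_intros)
  then have "((\<lambda>r. w (of_real r * z)) has_real_derivative D z) (at 1)"
    using assms by (intro has_real_derivative_along_curve) auto
  then show ?thesis unfolding normal_deriv_def by (rule DERIV_imp_deriv)
qed

lemma reflected_interval:
  fixes r :: real
  assumes "r > 0" "t \<in> {min r (1 / r)..max r (1 / r)}"
  shows "t > 0" "1 / t \<in> {min r (1 / r)..max r (1 / r)}"
proof -
  have "0 < min r (1 / r)" using assms(1) by simp
  also have "\<dots> \<le> t" using assms(2) by simp
  finally show t: "t > 0" .
  \<comment> \<open>Being above the minimum means \<open>r \<le> t\<close> or
    \<open>1 / r \<le> t\<close>; inversion turns this into being below the maximum, and the next
    fact is the converse bound.\<close>
  have "1 / t \<le> 1 / r \<or> 1 / t \<le> 1 / (1 / r)"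
    using assms t by (intro disj_forward[OF _ frac_le frac_le]) auto
  moreover have "1 / r \<le> 1 / t \<or> 1 / (1 / r) \<le> 1 / t"
    using assms t by (intro disj_forward[OF _ frac_le frac_le]) auto
  ultimately show "1 / t \<in> {min r (1 / r)..max r (1 / r)}" by auto
qed

text \<open>Here \<open>P t\<close> stands for \<open>t\<close> times the derivative of
  \<open>v\<close>. After division by \<open>t\<close>, the sum
  \<open>\<psi> t + \<psi> (1 / t)\<close> is the derivative of
  \<open>\<Psi> t - \<Psi> (1 / t)\<close> for a primitive \<open>\<Psi>\<close> of
  \<open>\<psi> t / t\<close>, and \<open>P t + P (1 / t)\<close> that of
  \<open>v t - v (1 / t)\<close>. Bounds with \<open>min\<close> and \<open>max\<close> and oriented
  integrals cover \<open>r\<close> on either side of 1.\<close>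

lemma radial_integral_identity:
  fixes v P :: "real \<Rightarrow> real" and \<psi> :: "real \<Rightarrow> complex" and a b r :: real
  defines "I \<equiv> {min r (1 / r)..max r (1 / r)}"
  assumes "r > 0"
    and v: "\<And>t. t \<in> I \<Longrightarrow> (v has_real_derivative P t / t) (at t)"
    and \<psi>: "continuous_on I \<psi>"
    and eq: "\<And>t. t \<in> I \<Longrightarrow>
      \<psi> t + \<psi> (1 / t) = of_real (a * (v t + v (1 / t)) + b * (P t + P (1 / t)))"
  shows "complex_of_real b * (v (1 / r) - v r) =
    - complex_of_real a * of_real (LBINT \<rho>=r..1. (v \<rho> + v (1 / \<rho>)) / \<rho>)
    - (LBINT \<rho>=1/r..r. \<psi> \<rho> / complex_of_real \<rho>)"
proof -
  have I: "t > 0" "1 / t \<in> I" if "t \<in> I" for t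
    using reflected_interval[OF \<open>r > 0\<close>] that unfolding I_def by auto
  have mem: "r \<in> I" "1 / r \<in> I" "1 \<in> I"
    using \<open>r > 0\<close> by (cases "r \<le> 1"; auto simp: I_def min_le_iff_disj le_max_iff_disj)+
  have cont: "continuous_on I (\<lambda>t. \<psi> t / complex_of_real t)"
    using I(1) by (intro continuous_intros \<psi>) auto
  then obtain \<Psi> where \<Psi>: "\<And>t. t \<in> I \<Longrightarrow> (\<Psi> has_vector_derivative \<psi> t / of_real t) (at t within I)"
    unfolding I_def using antiderivative_continuous by blast
  have inv: "((\<lambda>t. 1 / t) has_real_derivative - 1 / t\<^sup>2) (at t within I)" if "t \<in> I" for t
    using I(1)[OF that] by (auto intro!: derivative_eq_intros simp: power2_eq_square)
  \<comment> \<open>\<open>\<Psi>\<close> is known to be differentiable only within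
    \<open>I\<close>, so the chain rule needs inversion to map \<open>I\<close> into itself.\<close>
  have inv_img: "(\<lambda>t. 1 / t) ` I \<subseteq> I" using I by auto
  have \<Psi>': "((\<lambda>t. \<Psi> (1 / t)) has_vector_derivative - \<psi> (1 / t) / of_real t) (at t within I)"
    if "t \<in> I" for t
  proof -
    have "(\<Psi> \<circ> (\<lambda>t. 1 / t) has_vector_derivative (- 1 / t\<^sup>2) *\<^sub>R (\<psi> (1 / t) / of_real (1 / t))) (at t within I)"
      using inv[OF that] has_vector_derivative_within_subset[OF \<Psi>[OF I(2)[OF that]] inv_img]
      by (intro vector_diff_chain_within)
         (auto simp: has_real_derivative_iff_has_vector_derivative)
    then show ?thesis
      using I(1)[OF that] by (simp add: o_def scaleR_conv_of_real power2_eq_square)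
  qed
  have v': "((\<lambda>t. v (1 / t)) has_real_derivative - P (1 / t) / t) (at t within I)" if "t \<in> I" for t
    using DERIV_chain2[OF v[OF I(2)[OF that]] inv[OF that]] I(1)[OF that]
    by (simp add: power2_eq_square)
  \<comment> \<open>\<open>?F\<close> is odd under \<open>t \<mapsto> 1 / t\<close> and hence
    vanishes at 1, so integrating its derivative \<open>?q\<close> from \<open>r\<close> to 1 leaves
    only \<open>- ?F r\<close>.\<close>
  let ?F = "\<lambda>t. \<Psi> t - \<Psi> (1 / t) - of_real (b * (v t - v (1 / t)))"
  let ?q = "\<lambda>t. complex_of_real (a * ((v t + v (1 / t)) / t))"
  have F: "(?F has_vector_derivative ?q t) (at t within I)" if t: "t \<in> I" for t
  proof -
    have "((\<lambda>t. b * (v t - v (1 / t))) has_real_derivative b * (P t / t - - P (1 / t) / t)) (at t within I)"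
      by (intro DERIV_cmult DERIV_diff v' t has_field_derivative_at_within[OF v])
    then have "(?F has_vector_derivative \<psi> t / of_real t - - \<psi> (1 / t) / of_real t
       - of_real (b * (P t / t - - P (1 / t) / t))) (at t within I)"
      by (intro has_vector_derivative_diff \<Psi> \<Psi>' t has_vector_derivative_of_real)
    also have "\<psi> t / of_real t - - \<psi> (1 / t) / of_real t = (\<psi> t + \<psi> (1 / t)) / of_real t"
      by (simp add: add_divide_distrib)
    also have "\<dots> - of_real (b * (P t / t - - P (1 / t) / t)) = ?q t"
      unfolding eq[OF t] using I(1)[OF t] by (simp add: field_simps)
    finally show ?thesis .
  qed
  have sub: "{min r 1..max r 1} \<subseteq> I" "{min (1 / r) r..max (1 / r) r} \<subseteq> I"
    using mem unfolding I_def by auto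
  have cv: "continuous_on I v" "continuous_on I (\<lambda>t. v (1 / t))"
    by (rule DERIV_continuous_on, rule has_field_derivative_at_within[OF v] v', assumption)+
  have cq: "continuous_on I ?q"
    using I(1) by (intro continuous_intros cv) auto
  have "(LBINT t=r..1. ?q t) = (LBINT t=ereal r..ereal 1. ?q t)" by (simp add: one_ereal_def)
  also have "\<dots> = ?F 1 - ?F r"
  proof (rule interval_integral_FTC_finite)
    show "continuous_on {min r 1..max r 1} ?q" using cq sub(1) by (rule continuous_on_subset)
    show "(?F has_vector_derivative ?q t) (at t within {min r 1..max r 1})"
      if "min r 1 \<le> t" "t \<le> max r 1" for t
      using that sub(1) by (intro has_vector_derivative_within_subset[OF F sub(1)]) auto
  qed
  finally have "(LBINT t=r..1. ?q t) = - ?F r" by simp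
  then have A: "of_real a * of_real (LBINT t=r..1. (v t + v (1 / t)) / t) = - ?F r"
    unfolding interval_lebesgue_integral_of_real interval_lebesgue_integral_mult_right by simp
  have B: "(LBINT t=1/r..r. \<psi> t / complex_of_real t) = \<Psi> r - \<Psi> (1 / r)"
  proof (rule interval_integral_FTC_finite)
    show "continuous_on {min (1 / r) r..max (1 / r) r} (\<lambda>t. \<psi> t / complex_of_real t)"
      using cont sub(2) by (rule continuous_on_subset)
    show "(\<Psi> has_vector_derivative \<psi> t / complex_of_real t) (at t within {min (1 / r) r..max (1 / r) r})"
      if "min (1 / r) r \<le> t" "t \<le> max (1 / r) r" for t
      using that sub(2) by (intro has_vector_derivative_within_subset[OF \<Psi> sub(2)]) auto
  qed
  show ?thesis
    unfolding B mult_minus_left A by (simp add: algebra_simps)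
qed

section \<open>The reflection formula for the Robin condition\<close>

theorem theorem4:
  fixes a b :: real
    and \<Gamma> \<Omega> :: "complex set"
    and \<phi> :: "complex \<times> complex \<Rightarrow> complex"
    and w :: "complex \<Rightarrow> real"
    and U :: "(complex \<times> complex) set"
    and r \<theta> :: real
  assumes "b \<noteq> 0"
    and "open_circle_arc \<Gamma>"
    and "open \<Omega>" and "connected \<Omega>" and "simply_connected \<Omega>"
    and "0 \<notin> \<Omega>" and "\<Gamma> \<subseteq> \<Omega>"
    and "(\<lambda>z. 1 / cnj z) ` \<Omega> = \<Omega>"
    and "open U" and "{(z, 1 / z) | z. z \<in> \<Omega>} \<subseteq> U" and "holomorphic2_on \<phi> U"
    and "harmonic_on w \<Omega>"
    and "\<And>z. z \<in> \<Gamma> \<Longrightarrow> complex_of_real (a * w z + b * normal_deriv w z) = \<phi> (z, cnj z)"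
    and "r > 0" and "rcis r \<theta> \<in> \<Omega>" and "rcis (1 / r) \<theta> \<in> \<Omega>"
    and "cis \<theta> \<in> \<Gamma>"
    and "closed_segment (rcis r \<theta>) (rcis (1 / r) \<theta>) \<subseteq> \<Omega>"
  shows "complex_of_real (w (rcis (1 / r) \<theta>)) =
           complex_of_real (w (rcis r \<theta>)
             - a / b * (LBINT \<rho>=r..1. (w (rcis \<rho> \<theta>) + w (rcis (1 / \<rho>) \<theta>)) / \<rho>))
           - 1 / complex_of_real b *
               (LBINT \<rho>=1/r..r. \<phi> (rcis \<rho> \<theta>, 1 / rcis \<rho> \<theta>) / complex_of_real \<rho>)"
proof -
  obtain f g where f: "\<And>z. z \<in> \<Omega> \<Longrightarrow> (f has_field_derivative g z) (at z)"
    and dw: "\<And>z. z \<in> \<Omega> \<Longrightarrow> (w has_derivative (\<lambda>h. Re (g z * h))) (at z)"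
    and w: "\<And>z. z \<in> \<Omega> \<Longrightarrow> w z = Re (f z)"
    using harmonic_on_eq_Re[OF assms(12,5)] by blast
  define \<psi> where "\<psi> z = \<phi> (z, 1 / z)" for z
  have \<psi>: "\<psi> holomorphic_on \<Omega>"
    unfolding \<psi>_def using assms by (intro holomorphic2_on_hyperbola)
  have refl: "1 / cnj z \<in> \<Omega>" if "z \<in> \<Omega>" for z
    using assms(8) that by blast
  have robin: "complex_of_real (a * Re (f z) + b * Re (z * g z)) = \<psi> z" if z: "z \<in> \<Gamma>" for z
  proof -
    have z\<Omega>: "z \<in> \<Omega>" using assms(7) z by blast
    have "cnj z = 1 / z"
      using open_circle_arc_norm[OF assms(2) z] by (simp add: divide_conv_cnj)
    then show ?thesis
      using assms(13)[OF z] unfolding normal_deriv_eq[OF dw[OF z\<Omega>]] w[OF z\<Omega>] \<psi>_def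
      by (simp only: mult.commute)
  qed
  let ?I = "{min r (1 / r)..max r (1 / r)}"
  have ray: "rcis t \<theta> \<in> \<Omega>" if "t \<in> ?I" for t
    using rcis_in_closed_segment[OF that] assms(18) by blast
  \<comment> \<open>The radius times the radial derivative of \<open>w\<close> on the ray, in the
    form in which it enters \<open>robin_reflection\<close>.\<close>
  define P where "P t = Re (rcis t \<theta> * g (rcis t \<theta>))" for t
  have "complex_of_real b * (w (rcis (1 / r) \<theta>) - w (rcis r \<theta>)) =
    - complex_of_real a * of_real (LBINT \<rho>=r..1. (w (rcis \<rho> \<theta>) + w (rcis (1 / \<rho>) \<theta>)) / \<rho>)
    - (LBINT \<rho>=1/r..r. \<psi> (rcis \<rho> \<theta>) / complex_of_real \<rho>)"
  proof (rule radial_integral_identity[where P = P])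
    show "((\<lambda>t. w (rcis t \<theta>)) has_real_derivative P t / t) (at t)" if t: "t \<in> ?I" for t
    proof -
      have "((\<lambda>t. rcis t \<theta>) has_vector_derivative cis \<theta>) (at t)"
        unfolding rcis_def by (auto intro!: derivative_eq_intros)
      then have "((\<lambda>t. w (rcis t \<theta>)) has_real_derivative Re (g (rcis t \<theta>) * cis \<theta>)) (at t)"
        by (rule has_real_derivative_along_curve[where c = "\<lambda>t. rcis t \<theta>", OF dw[OF ray[OF t]]])
      also have "g (rcis t \<theta>) * cis \<theta> = rcis t \<theta> * g (rcis t \<theta>) / of_real t"
        using reflected_interval(1)[OF assms(14) t] by (simp add: rcis_def)
      finally show ?thesis by (simp only: P_def Re_divide_of_real)
    qed
    show "continuous_on ?I (\<lambda>t. \<psi> (rcis t \<theta>))"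
      using ray unfolding rcis_def
      by (intro continuous_on_compose2[OF holomorphic_on_imp_continuous_on[OF \<psi>]] continuous_intros) auto
    show "\<psi> (rcis t \<theta>) + \<psi> (rcis (1 / t) \<theta>) = complex_of_real
      (a * (w (rcis t \<theta>) + w (rcis (1 / t) \<theta>)) + b * (P t + P (1 / t)))" if t: "t \<in> ?I" for t
      using robin_reflection[OF f \<psi> assms(2,7,17,3,4,6) refl robin ray[OF t]]
      unfolding P_def w[OF ray[OF t]] w[OF ray[OF reflected_interval(2)[OF assms(14) t]]]
        rcis_inverse_eq .
  qed (fact assms(14))
  moreover have "x = y - of_real a / of_real b * A - 1 / of_real b * B"
    if "of_real b * (x - y) = - of_real a * A - B" for x y A B :: complex
  proof -
    have "x - y = (- of_real a * A - B) / of_real b"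
      using that assms(1) by (simp add: eq_divide_eq mult.commute)
    then show ?thesis by (simp add: field_simps diff_divide_distrib)
  qed
  ultimately show ?thesis
    unfolding \<psi>_def by (simp only: of_real_diff of_real_mult of_real_divide)
qed

end
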